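(* There exists an absolute constant $c_0>0$ such that for all positive integers $K,M,T$ and every strongly observable directed graph $G=([K],E)$, if $M\ge \mathsf{m}(G)$ and $T\ge \mathsf{m}(G)^3$, then $$R_T^\star(G,M)\ \ge\ c_0\sqrt{\mathsf{m}(G)\,T},$$ where $\mathsf{m}(G)$ is the maximum acyclic subgraph number of $G$ and $R_T^\star(G,M)$ is the minimax regret of stochastic contextual bandits with feedback graph $G$ across actions and complete cross-learning across $M$ contexts.
   Context: Graph conventions: $[n]=\{1,\dots,n\}$. For a directed graph $G=([K],E)$ (self-loops allowed), $u\to v$ means $(u,v)\in E$. $G$ is strongly observable if for every $a\in[K]$, either $a\to a$ or $a'\to a$ for all $a'\ne a$. The maximum acyclic subgraph (MAS) number is $\mathsf{m}(G)=\max\{|D|: D\subseteq[K]$ induces an acyclic subgraph of $G\}$, where acyclic means having no directed cycle other than self-loops. Stochastic contextual bandits with graph feedback and complete cross-learning: there are $M$ contexts, $K$ actions, a horizon $T$, and a known feedback graph $G$ on the actions. An environment consists of unknown means $\mu=(\mu_{c,a})_{c\in[M],a\in[K]}\in[0,1]^{M\times K}$ and reward vectors $(r_{t,c,a})_{c\in[M],a\in[K]}$, $t\in[T]$, independent across $t$, with $r_{t,c,a}\in[0,1]$ and $\mathbb{E}[r_{t,c,a}]=\mu_{c,a}$. An oblivious adversary fixes a context sequence $c^T=(c_1,\dots,c_T)\in[M]^T$. In each round $t$, the context $c_t$ is revealed, the learner chooses an action $a_t=\pi_t(c_t)\in[K]$ (possibly at random) based on past observations and $c_t$, and then observes $r_{t,c,a}$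 for all $c\in[M]$ and all $a$ with $(a_t,a)\in E$. The regret of a policy $\pi$ is $$R_T(\pi;G,M)=\sup_{c^T}\ \sup_{\mu}\ \mathbb{E}\Big[\sum_{t=1}^T\big(\max_{a\in[K]}\mu_{c_t,a}-\mu_{c_t,a_t}\big)\Big],$$ the supremum being over all context sequences and all environments, and $R_T^\star(G,M)=\inf_\pi R_T(\pi;G,M)$ over all such policies.
   Formalization: The formal theorem assumes K ≥ 2 instead of K ≥ 1: for K = 1 the learner has a single action, so m(G) = 1 and the minimax regret is 0, and the claimed lower bound c₀√T fails. *)

theory Defs
  imports "HOL-Probability.Probability"
begin

text \<open>A directed graph on the vertex set \<open>{1..K}\<close> is given by its edge set \<open>E \<subseteq> {1..K} \<times> {1..K}\<close>;
  self-loops are allowed.\<close>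

definition strongly_observable :: "nat \<Rightarrow> (nat \<times> nat) set \<Rightarrow> bool" where
  "strongly_observable K E \<longleftrightarrow>
     (\<forall>a\<in>{1..K}. (a, a) \<in> E \<or> (\<forall>a'\<in>{1..K}. a' \<noteq> a \<longrightarrow> (a', a) \<in> E))"

text \<open>Removing \<open>Id\<close> discards the self-loops, which do not count as cycles.\<close>

definition mas_number :: "nat \<Rightarrow> (nat \<times> nat) set \<Rightarrow> nat" where
  "mas_number K E = Max {card D | D. D \<subseteq> {1..K} \<and> acyclic (E \<inter> D \<times> D - Id)}"

text \<open>A reward vector maps a pair (context, action) to a reward. A history lists, for each past
  round, the context, the action played and the revealed part of the reward vector. A policy maps
  the history and the current context to a distribution over actions; the index of the current
  round is one more than the length of the history.\<close>

type_synonym reward_vector = "nat \<times> nat \<Rightarrow> real"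
type_synonym history = "(nat \<times> nat \<times> reward_vector) list"
type_synonym policy = "history \<Rightarrow> nat \<Rightarrow> nat pmf"

definition observed :: "nat \<Rightarrow> (nat \<times> nat) set \<Rightarrow> nat \<Rightarrow> (nat \<times> nat) set" where
  "observed M E a = {1..M} \<times> E `` {a}"

text \<open>Contexts and actions are discrete, so joint measurability of a policy in the history amounts
  to measurability in the observed rewards for every fixed sequence of contexts and actions.\<close>

definition policies :: "nat \<Rightarrow> nat \<Rightarrow> (nat \<times> nat) set \<Rightarrow> policy set" where
  "policies K M E = {\<pi>.
     (\<forall>h c. set_pmf (\<pi> h c) \<subseteq> {1..K}) \<and>
     (\<forall>t. \<forall>c\<in>{1..t} \<rightarrow> {1..M}. \<forall>a\<in>{1..<t} \<rightarrow> {1..K}. \<forall>b\<in>{1..K}.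
        (\<lambda>x. pmf (\<pi> (map (\<lambda>s. (c s, a s, x s)) [1..<t]) (c t)) b)
          \<in> borel_measurable (\<Pi>\<^sub>M s\<in>{1..<t}. \<Pi>\<^sub>M p\<in>observed M E (a s). borel))}"

text \<open>An environment consists of the means \<open>\<mu>\<close> and the law \<open>\<nu> t\<close> of the reward vector of each
  round \<open>t\<close>. Rewards may be dependent within a round and need not be identically distributed
  across rounds. Independence across rounds enters through the product measure used in
  \<open>expected_regret\<close>.\<close>

definition environments ::
    "nat \<Rightarrow> nat \<Rightarrow> nat \<Rightarrow> ((nat \<Rightarrow> nat \<Rightarrow> real) \<times> (nat \<Rightarrow> reward_vector measure)) set" where
  "environments K M T = {(\<mu>, \<nu>).
     (\<forall>c\<in>{1..M}. \<forall>a\<in>{1..K}. \<mu> c a \<in> {0..1}) \<and>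
     (\<forall>t\<in>{1..T}. prob_space (\<nu> t) \<and>
        sets (\<nu> t) = sets (\<Pi>\<^sub>M p\<in>{1..M} \<times> {1..K}. borel) \<and>
        (\<forall>c\<in>{1..M}. \<forall>a\<in>{1..K}.
           (AE x in \<nu> t. x (c, a) \<in> {0..1}) \<and> (\<integral>x. x (c, a) \<partial>\<nu> t) = \<mu> c a))}"

text \<open>The law of the history after \<open>t\<close> rounds given the realisation \<open>r\<close> of all reward vectors.
  The policy only sees the revealed entries of \<open>r\<close>.\<close>

primrec play ::
    "nat \<Rightarrow> (nat \<times> nat) set \<Rightarrow> policy \<Rightarrow> (nat \<Rightarrow> nat) \<Rightarrow> (nat \<Rightarrow> reward_vector) \<Rightarrow> nat \<Rightarrow> history pmf"
where
  "play M E \<pi> c r 0 = return_pmf []"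
| "play M E \<pi> c r (Suc t) =
     bind_pmf (play M E \<pi> c r t) (\<lambda>h.
     bind_pmf (\<pi> h (c (Suc t))) (\<lambda>a.
     return_pmf (h @ [(c (Suc t), a, restrict (r (Suc t)) (observed M E a))])))"

definition history_regret :: "nat \<Rightarrow> (nat \<Rightarrow> nat \<Rightarrow> real) \<Rightarrow> history \<Rightarrow> real" where
  "history_regret K \<mu> h = (\<Sum>(c, a, x)\<leftarrow>h. (MAX b\<in>{1..K}. \<mu> c b) - \<mu> c a)"

text \<open>Reward vectors are drawn independently across rounds, and the outer and inner expectations
  are over the rewards and the learner's randomisation, respectively.\<close>

definition expected_regret ::
    "nat \<Rightarrow> nat \<Rightarrow> nat \<Rightarrow> (nat \<times> nat) set \<Rightarrow> policy \<Rightarrow> (nat \<Rightarrow> nat) \<Rightarrow>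
     (nat \<Rightarrow> nat \<Rightarrow> real) \<Rightarrow> (nat \<Rightarrow> reward_vector measure) \<Rightarrow> real" where
  "expected_regret K M T E \<pi> c \<mu> \<nu> =
     (\<integral>r. measure_pmf.expectation (play M E \<pi> c r T) (history_regret K \<mu>)
        \<partial>(\<Pi>\<^sub>M t\<in>{1..T}. \<nu> t))"

text \<open>Suprema and infima are taken in \<^typ>\<open>ereal\<close>, where they always exist.\<close>

definition regret :: "nat \<Rightarrow> nat \<Rightarrow> nat \<Rightarrow> (nat \<times> nat) set \<Rightarrow> policy \<Rightarrow> ereal" where
  "regret K M T E \<pi> =
     (SUP c\<in>{1..T} \<rightarrow> {1..M}. SUP (\<mu>, \<nu>)\<in>environments K M T.
        ereal (expected_regret K M T E \<pi> c \<mu> \<nu>))"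

definition minimax_regret :: "nat \<Rightarrow> nat \<Rightarrow> nat \<Rightarrow> (nat \<times> nat) set \<Rightarrow> ereal" where
  "minimax_regret K M T E = (INF \<pi>\<in>policies K M E. regret K M T E \<pi>)"

end

theory Submission imports Defs begin

text \<open>
  Order a maximum acyclic set topologically as \<open>e\<^sub>0, \<dots>, e\<^sub>n\<close>, so that no action has an edge to a later
  one. Split the horizon into \<open>n\<close> blocks; block \<open>j\<close> only shows context \<open>j\<close>, in which \<open>e\<^sub>0\<close> has mean
  \<open>1/2\<close>, \<open>e\<^sub>j\<close> has mean \<open>1/2 \<plusminus> \<Delta>\<close> and all other actions have mean \<open>0\<close>. Before block \<open>j\<close> the learner
  can only learn about the sign \<open>\<theta>\<^sub>j\<close> through actions that cost at least \<open>1/2\<close> each, so a policy of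
  regret \<open>R\<close> has seen at most \<open>T/n + 2R\<close> samples of \<open>e\<^sub>j\<close> on average when it acts in block \<open>j\<close>. This
  count is taken in the environment \<open>\<theta>\<^sub>j = 0\<close>, which is also the reference measure for the two
  alternatives \<open>\<theta>\<^sub>j = \<plusminus>1\<close>: their likelihood ratios multiply to \<open>(1 - 4\<Delta>\<^sup>2)\<^sup>N\<close>, where \<open>N\<close> is the
  number of samples. For \<open>\<Delta>\<^sup>2 = n/(32T)\<close> the alternatives are therefore indistinguishable, and every
  round costs order \<open>\<Delta>\<close> on average over the signs. The condition \<open>T \<ge> m\<^sup>3\<close> makes the \<open>2R\<close> extra samples
  negligible. If \<open>m = 1\<close>, one block with two arbitrary actions suffices.
\<close>

section \<open>From reward measures to discrete history laws\<close>

lemma expectation_bind_pmf_finite: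
  fixes f :: "'b \<Rightarrow> real"
  assumes "finite (set_pmf p)" "\<And>x. x \<in> set_pmf p \<Longrightarrow> finite (set_pmf (q x))"
  shows "measure_pmf.expectation (bind_pmf p q) f =
    measure_pmf.expectation p (\<lambda>x. measure_pmf.expectation (q x) f)"
  using assms by (subst pmf_expectation_bind[of "set_pmf p"])
    (auto simp: integral_measure_pmf[of "set_pmf p"])

lemma expectation_mono_finite:
  fixes f g :: "'a \<Rightarrow> real"
  assumes "finite (set_pmf p)" "\<And>x. x \<in> set_pmf p \<Longrightarrow> f x \<le> g x"
  shows "measure_pmf.expectation p f \<le> measure_pmf.expectation p g"
  using assms by (intro integral_mono_AE) (auto simp: AE_measure_pmf_iff integrable_measure_pmf_finite)

text \<open>Both sides agree on boxes, and boxes determine a finite product measure. This turns the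
  product of reward laws in \<open>expected_regret\<close> into a discrete
  \<open>Pi_pmf\<close>.\<close>

lemma PiM_distr_measure_pmf:
  assumes "finite I" and f: "f \<in> measurable (count_space UNIV) N"
  shows "PiM I (\<lambda>_. distr (measure_pmf p) N f) =
    distr (measure_pmf (Pi_pmf I d (\<lambda>_. p))) (PiM I (\<lambda>_. N)) (\<lambda>b. \<lambda>i\<in>I. f (b i))"
proof -
  let ?D = "distr (measure_pmf p) N f"
  have f': "f \<in> measurable (measure_pmf q) N" for q
    using f by simp
  interpret D: prob_space ?D
    by (rule measure_pmf.prob_space_distr[OF f'])
  interpret product_sigma_finite "\<lambda>_. ?D"
    by unfold_locales
  have g: "(\<lambda>b. \<lambda>i\<in>I. f (b i)) \<in> measurable (measure_pmf q) (PiM I (\<lambda>_. N))" for q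
    using f by (intro measurable_restrict) (auto simp: measurable_def)
  show ?thesis
  proof (rule PiM_eqI[symmetric])
    show "finite I" by fact
    show "sets (distr (measure_pmf (Pi_pmf I d (\<lambda>_. p))) (PiM I (\<lambda>_. N)) (\<lambda>b. \<lambda>i\<in>I. f (b i))) =
        sets (PiM I (\<lambda>_. ?D))"
      by (auto intro!: sets_PiM_cong)
  next
    fix A assume A: "\<And>i. i \<in> I \<Longrightarrow> A i \<in> sets ?D"
    have "Pi\<^sub>E I A \<in> sets (PiM I (\<lambda>_. N))"
      using A assms(1) by (intro sets_PiM_I_finite) auto
    then have "emeasure (distr (measure_pmf (Pi_pmf I d (\<lambda>_. p))) (PiM I (\<lambda>_. N))
          (\<lambda>b. \<lambda>i\<in>I. f (b i))) (Pi\<^sub>E I A) =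
        emeasure (measure_pmf (Pi_pmf I d (\<lambda>_. p))) ((\<lambda>b. \<lambda>i\<in>I. f (b i)) -` Pi\<^sub>E I A)"
      using g by (subst emeasure_distr) auto
    also have "(\<lambda>b. \<lambda>i\<in>I. f (b i)) -` Pi\<^sub>E I A = Pi I (\<lambda>i. f -` A i)"
      by (auto simp: PiE_iff)
    also have "emeasure (measure_pmf (Pi_pmf I d (\<lambda>_. p))) \<dots> =
        (\<Prod>i\<in>I. emeasure (measure_pmf p) (f -` A i))"
      using measure_Pi_pmf_Pi[OF assms(1), of d "\<lambda>_. p" "\<lambda>i. f -` A i"]
      by (simp add: measure_pmf.emeasure_eq_measure prod_ennreal)
    also have "\<dots> = (\<Prod>i\<in>I. emeasure ?D (A i))"
      using A f by (intro prod.cong refl) (auto simp: emeasure_distr)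
    finally show "emeasure (distr (measure_pmf (Pi_pmf I d (\<lambda>_. p))) (PiM I (\<lambda>_. N))
          (\<lambda>b. \<lambda>i\<in>I. f (b i))) (Pi\<^sub>E I A) = (\<Prod>i\<in>I. emeasure ?D (A i))" .
  qed
qed

section \<open>Sampling the rewards round by round\<close>

lemma play_cong:
  assumes "\<And>s. s \<in> {1..t} \<Longrightarrow> r s = r' s"
  shows "play M E \<pi> c r t = play M E \<pi> c r' t"
  using assms by (induction t) auto

text \<open>Rewards enter a history only through the revealed entries, which lie in \<open>S\<close>
  for every action the policy can play.\<close>

lemma play_restrict:
  assumes "\<And>a h c. a \<in> set_pmf (\<pi> h c) \<Longrightarrow> observed M E a \<subseteq> S"
  shows "play M E \<pi> c (\<lambda>s. restrict (r s) S) t = play M E \<pi> c r t"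
proof (induction t)
  case (Suc t)
  have "restrict (restrict (r (Suc t)) S) (observed M E a) = restrict (r (Suc t)) (observed M E a)"
    if "a \<in> set_pmf (\<pi> h (c (Suc t)))" for a h
    using assms[OF that] by (simp add: Int_absorb1)
  then show ?case
    unfolding play.simps Suc by (intro bind_pmf_cong refl) (simp only:)
qed simp

primrec history_law ::
    "nat \<Rightarrow> (nat \<times> nat) set \<Rightarrow> policy \<Rightarrow> (nat \<Rightarrow> nat) \<Rightarrow> reward_vector pmf \<Rightarrow> nat \<Rightarrow> history pmf"
where
  "history_law M E \<pi> c p 0 = return_pmf []"
| "history_law M E \<pi> c p (Suc t) =
     bind_pmf (history_law M E \<pi> c p t) (\<lambda>h.
     bind_pmf (\<pi> h (c (Suc t))) (\<lambda>a.
     map_pmf (\<lambda>x. h @ [(c (Suc t), a, restrict x (observed M E a))]) p))"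

text \<open>The first \<open>t\<close> rounds and the next action do not depend on the reward of
  round \<open>Suc t\<close>, so its draw can be postponed until after that action.\<close>

lemma bind_Pi_pmf_play:
  "bind_pmf (Pi_pmf {1..t} d (\<lambda>_. p)) (\<lambda>r. play M E \<pi> c r t) = history_law M E \<pi> c p t"
proof (induction t)
  case (Suc t)
  have *: "{1..Suc t} = insert (Suc t) {1..t}"
    by auto
  have pl: "play M E \<pi> c (r(Suc t := x)) t = play M E \<pi> c r t" for r x
    by (rule play_cong) auto
  have "bind_pmf (Pi_pmf {1..Suc t} d (\<lambda>_. p)) (\<lambda>r. play M E \<pi> c r (Suc t)) =
    bind_pmf p (\<lambda>x. bind_pmf (Pi_pmf {1..t} d (\<lambda>_. p)) (\<lambda>r.
      bind_pmf (play M E \<pi> c r t) (\<lambda>h. bind_pmf (\<pi> h (c (Suc t))) (\<lambda>a.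
      return_pmf (h @ [(c (Suc t), a, restrict x (observed M E a))])))))"
    unfolding * by (subst Pi_pmf_insert') (simp_all add: bind_assoc_pmf bind_return_pmf pl)
  also have "\<dots> = bind_pmf p (\<lambda>x. bind_pmf (history_law M E \<pi> c p t)
      (\<lambda>h. bind_pmf (\<pi> h (c (Suc t))) (\<lambda>a.
      return_pmf (h @ [(c (Suc t), a, restrict x (observed M E a))]))))"
    unfolding Suc.IH[symmetric] by (simp add: bind_assoc_pmf)
  also have "\<dots> = history_law M E \<pi> c p (Suc t)"
    by (subst bind_commute_pmf)
      (auto intro!: bind_pmf_cong simp: map_pmf_def bind_commute_pmf[of p])
  finally show ?case .
qed simp

text \<open>Given the rewards, the history is a function of the actions. Hence the expected regret is a
  finite sum over action lists, which gives its measurability in the rewards.\<close>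

definition make_history ::
    "nat \<Rightarrow> (nat \<times> nat) set \<Rightarrow> (nat \<Rightarrow> nat) \<Rightarrow> (nat \<Rightarrow> reward_vector) \<Rightarrow> nat list \<Rightarrow> history" where
  "make_history M E c r as = map (\<lambda>s. (c s, as ! (s - 1), restrict (r s) (observed M E (as ! (s - 1)))))
     [1..<Suc (length as)]"

primrec play_actions ::
    "nat \<Rightarrow> (nat \<times> nat) set \<Rightarrow> policy \<Rightarrow> (nat \<Rightarrow> nat) \<Rightarrow> (nat \<Rightarrow> reward_vector) \<Rightarrow> nat \<Rightarrow> nat list pmf"
where
  "play_actions M E \<pi> c r 0 = return_pmf []"
| "play_actions M E \<pi> c r (Suc t) =
     bind_pmf (play_actions M E \<pi> c r t) (\<lambda>as.
     map_pmf (\<lambda>a. as @ [a]) (\<pi> (make_history M E c r as) (c (Suc t))))"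

lemma make_history_snoc:
  "make_history M E c r (as @ [a]) = make_history M E c r as @
     [(c (Suc (length as)), a, restrict (r (Suc (length as))) (observed M E a))]"
  by (auto simp: make_history_def nth_append)

lemma length_play_actions: "as \<in> set_pmf (play_actions M E \<pi> c r t) \<Longrightarrow> length as = t"
  by (induction t arbitrary: as) auto

lemma play_eq_map_play_actions:
  "play M E \<pi> c r t = map_pmf (make_history M E c r) (play_actions M E \<pi> c r t)"
proof (induction t)
  case (Suc t)
  show ?case
    by (auto simp: Suc map_bind_pmf bind_map_pmf pmf.map_comp o_def make_history_snoc map_pmf_def[symmetric]
        dest!: length_play_actions intro!: bind_pmf_cong)
qed (simp add: make_history_def)

text \<open>With the actions fixed, the history is obtained from the rewards by coordinate
  projections, so the measurability condition in \<open>policies\<close> can be composed with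
  them.\<close>

lemma measurable_pmf_policy:
  assumes \<pi>: "\<pi> \<in> policies K M E" and c: "c \<in> {1..T} \<rightarrow> {1..M}" and E: "E \<subseteq> {1..K} \<times> {1..K}"
    and as: "set as \<subseteq> {1..K}" "length as < T" and a: "a \<in> {1..K}"
  shows "(\<lambda>r. pmf (\<pi> (make_history M E c r as) (c (Suc (length as)))) a)
    \<in> borel_measurable (PiM {1..T} (\<lambda>_. PiM ({1..M} \<times> {1..K}) (\<lambda>_. borel)))"
proof -
  define f where "f s = as ! (s - 1)" for s
  let ?t = "Suc (length as)"
  have 1: "c \<in> {1..?t} \<rightarrow> {1..M}"
    using c as by auto
  have f: "f \<in> {1..<?t} \<rightarrow> {1..K}"
    using as(1) by (auto simp: f_def subset_iff Suc_le_eq)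
  have m: "(\<lambda>x. pmf (\<pi> (map (\<lambda>s. (c s, f s, x s)) [1..<?t]) (c ?t)) a)
          \<in> borel_measurable (\<Pi>\<^sub>M s\<in>{1..<?t}. \<Pi>\<^sub>M p\<in>observed M E (f s). borel)"
    using \<pi> 1 f a unfolding policies_def by blast
  have g: "(\<lambda>r. \<lambda>s\<in>{1..<?t}. restrict (r s) (observed M E (f s)))
      \<in> measurable (PiM {1..T} (\<lambda>_. PiM ({1..M} \<times> {1..K}) (\<lambda>_. borel)))
        (\<Pi>\<^sub>M s\<in>{1..<?t}. \<Pi>\<^sub>M p\<in>observed M E (f s). borel)"
  proof (rule measurable_restrict)
    fix s assume s: "s \<in> {1..<?t}"
    have "observed M E (f s) \<subseteq> {1..M} \<times> {1..K}"
      using E by (auto simp: observed_def)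
    then have 2: "(\<lambda>x. restrict x (observed M E (f s)))
        \<in> measurable (PiM ({1..M} \<times> {1..K}) (\<lambda>_. borel)) (\<Pi>\<^sub>M p\<in>observed M E (f s). borel)"
      by (rule measurable_restrict_subset)
    have 1: "(\<lambda>r. r s) \<in> measurable (PiM {1..T} (\<lambda>_. PiM ({1..M} \<times> {1..K}) (\<lambda>_. borel)))
        (PiM ({1..M} \<times> {1..K}) (\<lambda>_. borel))"
      using s as(2) by (intro measurable_component_singleton) auto
    show "(\<lambda>r. restrict (r s) (observed M E (f s)))
      \<in> measurable (PiM {1..T} (\<lambda>_. PiM ({1..M} \<times> {1..K}) (\<lambda>_. borel)))
          (\<Pi>\<^sub>M p\<in>observed M E (f s). borel)"
      by (rule measurable_compose[OF 1 2])
  qed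
  have "map (\<lambda>s. (c s, f s, (\<lambda>s\<in>{1..<?t}. restrict (r s) (observed M E (f s))) s)) [1..<?t] =
      make_history M E c r as" for r
    unfolding make_history_def f_def by (intro map_cong) auto
  with measurable_compose[OF g m] show ?thesis
    by (simp only:)
qed

lemma set_play_actions:
  assumes \<pi>: "\<pi> \<in> policies K M E"
  shows "set_pmf (play_actions M E \<pi> c r t) \<subseteq> {as. set as \<subseteq> {1..K} \<and> length as = t}"
  using assms by (induction t) (fastforce simp: policies_def)+

text \<open>The probability of an action list is a product of conditional probabilities along its
  prefixes, each of them measurable in the rewards.\<close>

lemma measurable_pmf_play_actions:
  assumes \<pi>: "\<pi> \<in> policies K M E" and c: "c \<in> {1..T} \<rightarrow> {1..M}" and E: "E \<subseteq> {1..K} \<times> {1..K}"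
    and as: "set as \<subseteq> {1..K}" "length as \<le> T"
  shows "(\<lambda>r. pmf (play_actions M E \<pi> c r (length as)) as)
    \<in> borel_measurable (PiM {1..T} (\<lambda>_. PiM ({1..M} \<times> {1..K}) (\<lambda>_. borel)))"
  using as
proof (induction as rule: rev_induct)
  case (snoc a as)
  have "pmf (play_actions M E \<pi> c r (Suc (length as))) (as @ [a]) =
      pmf (play_actions M E \<pi> c r (length as)) as *
      pmf (\<pi> (make_history M E c r as) (c (Suc (length as)))) a" for r
  proof -
    have fin: "finite {bs. set bs \<subseteq> {1..K} \<and> length bs = length as}"
      by (rule finite_lists_length_eq) simp
    \<comment> \<open>Only the prefix \<open>as\<close> can be extended to \<open>as @ [a]\<close>,
      so the integral over prefixes has a single nonzero term.\<close>
    have m: "pmf (map_pmf (\<lambda>a. bs @ [a]) (\<pi> (make_history M E c r bs) (c (Suc (length as))))) (as @ [a]) =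
        (if bs = as then pmf (\<pi> (make_history M E c r as) (c (Suc (length as)))) a else 0)" for bs
    proof (cases "bs = as")
      case True
      then show ?thesis
        by (auto intro!: pmf_map_inj' inj_onI simp: inj_def)
    qed (auto intro!: pmf_map_outside)
    show ?thesis
      using snoc.prems fin
      by (simp add: pmf_bind m, subst integral_measure_pmf[OF fin])
        (use set_play_actions[OF \<pi>, of c r "length as"] in \<open>auto simp: sum.delta if_distrib cong: if_cong\<close>)
  qed
  then show ?case
    using snoc measurable_pmf_policy[OF \<pi> c E, of as a]
    by (auto simp del: play_actions.simps intro!: borel_measurable_times)
qed simp

lemma history_regret_make_history:
  "history_regret K \<mu> (make_history M E c r as) =
     (\<Sum>s\<leftarrow>[1..<Suc (length as)]. (MAX b\<in>{1..K}. \<mu> (c s) b) - \<mu> (c s) (as ! (s - 1)))"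
  by (simp add: history_regret_def make_history_def o_def del: upt_Suc)

lemma measurable_expected_history_regret:
  assumes \<pi>: "\<pi> \<in> policies K M E" and c: "c \<in> {1..T} \<rightarrow> {1..M}" and E: "E \<subseteq> {1..K} \<times> {1..K}"
  shows "(\<lambda>r. measure_pmf.expectation (play M E \<pi> c r T) (history_regret K \<mu>))
    \<in> borel_measurable (PiM {1..T} (\<lambda>_. PiM ({1..M} \<times> {1..K}) (\<lambda>_. borel)))"
proof -
  let ?A = "{as. set as \<subseteq> {1..K} \<and> length as = T}"
  let ?g = "\<lambda>as. \<Sum>s\<leftarrow>[1..<Suc (length as)]. (MAX b\<in>{1..K}. \<mu> (c s) b) - \<mu> (c s) (as ! (s - 1))"
  have fin: "finite ?A"
    by (rule finite_lists_length_eq) simp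
  \<comment> \<open>Only the probabilities depend on \<open>r\<close>: the regret of a history
    involves its contexts and actions but not its rewards.\<close>
  have "measure_pmf.expectation (play M E \<pi> c r T) (history_regret K \<mu>) =
      (\<Sum>as\<in>?A. pmf (play_actions M E \<pi> c r (length as)) as * ?g as)" for r
    unfolding play_eq_map_play_actions integral_map_pmf history_regret_make_history
    using set_play_actions[OF \<pi>, of c r T]
    by (subst integral_measure_pmf[OF fin]) (auto intro!: sum.cong simp del: upt_Suc)
  moreover have "(\<lambda>r. \<Sum>as\<in>?A. pmf (play_actions M E \<pi> c r (length as)) as * ?g as)
    \<in> borel_measurable (PiM {1..T} (\<lambda>_. PiM ({1..M} \<times> {1..K}) (\<lambda>_. borel)))"
    using measurable_pmf_play_actions[OF \<pi> c E]
    by (intro borel_measurable_sum borel_measurable_times) auto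
  ultimately show ?thesis
    by (simp only:)
qed

text \<open>Points of the product space are undefined outside the index set, hence the
  restriction.\<close>

definition reward_measure :: "nat \<Rightarrow> nat \<Rightarrow> reward_vector pmf \<Rightarrow> reward_vector measure" where
  "reward_measure K M p = distr (measure_pmf p) (\<Pi>\<^sub>M q\<in>{1..M} \<times> {1..K}. borel)
     (\<lambda>x. restrict x ({1..M} \<times> {1..K}))"

lemma measurable_restrict_pmf:
  "(\<lambda>x. restrict x S) \<in> measurable (measure_pmf p) (\<Pi>\<^sub>M q\<in>S. borel)"
  by (auto intro!: measurable_restrict simp: space_PiM)

lemma finite_set_history_law:
  assumes "finite (set_pmf p)" "\<And>h c. finite (set_pmf (\<pi> h c))"
  shows "finite (set_pmf (history_law M E \<pi> c p t))"
  using assms by (induction t) auto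

lemma finite_set_policy: "\<pi> \<in> policies K M E \<Longrightarrow> finite (set_pmf (\<pi> h c))"
  by (rule finite_subset[of _ "{1..K}"]) (auto simp: policies_def)

lemma finite_set_play:
  assumes "\<And>h c. finite (set_pmf (\<pi> h c))"
  shows "finite (set_pmf (play M E \<pi> c r t))"
  using assms by (induction t) auto

text \<open>The product measure is the image of a \<open>Pi_pmf\<close>, the learner does not notice
  the restriction to the index set, and the two nested expectations merge into one
  \<open>bind_pmf\<close>. From here on everything is discrete.\<close>

lemma expected_regret_reward_measure:
  assumes \<pi>: "\<pi> \<in> policies K M E" and c: "c \<in> {1..T} \<rightarrow> {1..M}" and E: "E \<subseteq> {1..K} \<times> {1..K}"
    and p: "finite (set_pmf p)"
  shows "expected_regret K M T E \<pi> c \<mu> (\<lambda>_. reward_measure K M p) =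
    measure_pmf.expectation (history_law M E \<pi> c p T) (history_regret K \<mu>)"
proof -
  let ?S = "{1..M} \<times> {1..K}" and ?I = "{1..T}"
  let ?R = "Pi_pmf ?I undefined (\<lambda>_. p)"
  have pl: "play M E \<pi> c (\<lambda>t\<in>?I. restrict (r t) ?S) T = play M E \<pi> c r T" for r
  proof -
    have "play M E \<pi> c (\<lambda>t\<in>?I. restrict (r t) ?S) T = play M E \<pi> c (\<lambda>t. restrict (r t) ?S) T"
      by (rule play_cong) auto
    also have "\<dots> = play M E \<pi> c r T"
      by (rule play_restrict) (use E in \<open>auto simp: observed_def\<close>)
    finally show ?thesis .
  qed
  have "PiM ?I (\<lambda>_. reward_measure K M p) =
      distr (measure_pmf ?R) (PiM ?I (\<lambda>_. \<Pi>\<^sub>M q\<in>?S. borel)) (\<lambda>r. \<lambda>t\<in>?I. restrict (r t) ?S)"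
    unfolding reward_measure_def
    by (rule PiM_distr_measure_pmf) (auto simp: space_PiM)
  then have "expected_regret K M T E \<pi> c \<mu> (\<lambda>_. reward_measure K M p) =
      measure_pmf.expectation ?R (\<lambda>r. measure_pmf.expectation
        (play M E \<pi> c (\<lambda>t\<in>?I. restrict (r t) ?S) T) (history_regret K \<mu>))"
    unfolding expected_regret_def
    using measurable_expected_history_regret[OF \<pi> c E]
    by (simp, subst integral_distr)
      (auto intro!: measurable_restrict measurable_compose[OF _ measurable_restrict_pmf] simp: space_PiM)
  also have "\<dots> = measure_pmf.expectation (bind_pmf ?R (\<lambda>r. play M E \<pi> c r T)) (history_regret K \<mu>)"
    unfolding pl using p
    by (subst expectation_bind_pmf_finite)
      (auto intro!: finite_set_play finite_set_policy[OF \<pi>] simp: set_Pi_pmf)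
  finally show ?thesis
    unfolding bind_Pi_pmf_play .
qed

lemma reward_measure_in_environments:
  assumes "\<And>c a. \<lbrakk>c \<in> {1..M}; a \<in> {1..K}\<rbrakk> \<Longrightarrow> \<mu> c a \<in> {0..1}"
    and "\<And>x c a. \<lbrakk>x \<in> set_pmf p; c \<in> {1..M}; a \<in> {1..K}\<rbrakk> \<Longrightarrow> x (c, a) \<in> {0..1}"
    and "\<And>c a. \<lbrakk>c \<in> {1..M}; a \<in> {1..K}\<rbrakk> \<Longrightarrow> measure_pmf.expectation p (\<lambda>x. x (c, a)) = \<mu> c a"
  shows "(\<mu>, \<lambda>_. reward_measure K M p) \<in> environments K M T"
proof -
  let ?S = "{1..M} \<times> {1..K}"
  have r: "(\<lambda>x. restrict x ?S) \<in> measurable (measure_pmf p) (\<Pi>\<^sub>M q\<in>?S. borel)"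
    by (rule measurable_restrict_pmf)
  have "prob_space (reward_measure K M p)"
    unfolding reward_measure_def by (rule measure_pmf.prob_space_distr[OF r])
  moreover have "AE x in reward_measure K M p. x (c, a) \<in> {0..1}"
    if "c \<in> {1..M}" "a \<in> {1..K}" for c a
    unfolding reward_measure_def using assms(2) that r
    by (subst AE_distr_iff) (auto simp: AE_measure_pmf_iff simp del: atLeastAtMost_iff)
  moreover have "(\<integral>x. x (c, a) \<partial>reward_measure K M p) = \<mu> c a"
    if "c \<in> {1..M}" "a \<in> {1..K}" for c a
    unfolding reward_measure_def using assms(3) that
    by (subst integral_distr[OF r]) auto
  moreover have "sets (reward_measure K M p) = sets (\<Pi>\<^sub>M q\<in>?S. borel)"
    by (simp add: reward_measure_def)
  ultimately show ?thesis
    using assms(1) by (simp add: environments_def)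
qed

section \<open>Additive functionals and change of measure for history laws\<close>

lemma expectation_history_law_Suc:
  fixes f :: "history \<Rightarrow> real"
  assumes "finite (set_pmf p)" "\<And>h c. finite (set_pmf (\<pi> h c))"
  shows "measure_pmf.expectation (history_law M E \<pi> c p (Suc t)) f =
    measure_pmf.expectation (history_law M E \<pi> c p t) (\<lambda>h.
    measure_pmf.expectation (\<pi> h (c (Suc t))) (\<lambda>a.
    measure_pmf.expectation p (\<lambda>x. f (h @ [(c (Suc t), a, restrict x (observed M E a))]))))"
  using assms finite_set_history_law[of p \<pi> M E c t]
  by (simp add: expectation_bind_pmf_finite)

text \<open>Each summand depends only on the context and action of its round, so conditioning on the
  earlier history leaves an expectation over the policy. Applied to both regret and observation
  counts.\<close>

lemma expectation_history_law_sum_list: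
  fixes g :: "nat \<Rightarrow> nat \<Rightarrow> real"
  assumes p: "finite (set_pmf p)" and \<pi>: "\<And>h c. finite (set_pmf (\<pi> h c))"
  shows "measure_pmf.expectation (history_law M E \<pi> c p t) (\<lambda>h. \<Sum>(c, a, x)\<leftarrow>h. g c a) =
    (\<Sum>u<t. measure_pmf.expectation (history_law M E \<pi> c p u) (\<lambda>h.
      measure_pmf.expectation (\<pi> h (c (Suc u))) (g (c (Suc u)))))"
proof (induction t)
  case (Suc t)
  note fin = finite_set_history_law[of p \<pi> M E c t, OF assms]
  show ?case
    unfolding expectation_history_law_Suc[OF assms]
    using fin p \<pi> by (simp add: integrable_measure_pmf_finite Suc.IH)
qed simp

text \<open>The action probabilities given the history are the same under both laws, so only the
  densities of the observed rewards remain, and these multiply over the rounds. In the induction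
  \<open>f\<close> varies because the last round is integrated out first.\<close>

lemma expectation_history_law_change_of_measure:
  fixes f :: "history \<Rightarrow> real" and w :: "nat \<Rightarrow> reward_vector \<Rightarrow> real"
  assumes fin: "finite (set_pmf p)" "finite (set_pmf q)" "\<And>h c. finite (set_pmf (\<pi> h c))"
    and w: "\<And>a (g :: reward_vector \<Rightarrow> real).
      measure_pmf.expectation p (\<lambda>x. g (restrict x (observed M E a))) =
      measure_pmf.expectation q (\<lambda>x. g (restrict x (observed M E a)) * w a (restrict x (observed M E a)))"
  shows "measure_pmf.expectation (history_law M E \<pi> c p t) f =
    measure_pmf.expectation (history_law M E \<pi> c q t) (\<lambda>h. f h * (\<Prod>(c, a, x)\<leftarrow>h. w a x))"
proof (induction t arbitrary: f)
  case (Suc t)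
  show ?case
    unfolding expectation_history_law_Suc[OF fin(1,3)] expectation_history_law_Suc[OF fin(2,3)]
      w[of "\<lambda>x. f (_ @ [(_, _, x)])"] Suc.IH
    by (simp flip: integral_mult_left_zero add: mult_ac)
qed simp

text \<open>For likelihood ratios \<open>x\<close>, \<open>y\<close> of two alternatives, the right-hand side is the error of the test
  that rejects the first with probability \<open>1 - p\<close>. The bound is a linear version of \<open>\<surd>(xy) \<le> min x y + max x y / 4\<close>.\<close>

lemma overlap_bound:
  fixes x y p :: real
  assumes "0 \<le> x" "0 \<le> y" "x * y \<le> 1" "0 \<le> p" "p \<le> 1"
  shows "x * y - (x + y) / 4 \<le> (1 - p) * x + p * y"
proof -
  define m M where "m = min x y" and "M = max x y"
  have m: "0 \<le> m" "m \<le> M" "x * y = m * M" "x + y = m + M"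
    using assms by (auto simp: m_def M_def min_def max_def mult_ac)
  have "(x * y)\<^sup>2 \<le> x * y"
    using assms by (simp add: power2_eq_square mult_left_le)
  \<comment> \<open>AM-GM in the form
    \<open>4 * m * (M / 4) \<le> (m + M / 4)\<^sup>2\<close>.\<close>
  also have "\<dots> \<le> (m + M / 4)\<^sup>2"
    unfolding m using sum_squares_bound[of m "M / 4"] zero_le_power2[of "m - M / 4"]
    by (simp add: power2_eq_square algebra_simps)
  finally have "x * y \<le> m + M / 4"
    by (rule power2_le_imp_le) (use m(1,2) in linarith)
  then have "x * y - (x + y) / 4 \<le> m"
    using m(1) unfolding m(4) by (simp add: field_simps)
  moreover have "(1 - p) * m \<le> (1 - p) * x" "p * m \<le> p * y"
    using assms by (auto intro!: mult_left_mono simp: m_def)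
  moreover from this have "m \<le> (1 - p) * x + p * y"
    by (simp add: algebra_simps)
  ultimately show ?thesis
    by (meson order_trans)
qed

section \<open>The hard instances\<close>

definition signs :: "nat set \<Rightarrow> nat \<Rightarrow> real" where
  "signs S i = (if i \<in> S then 1 else -1)"

text \<open>Flipping the sign at \<open>j\<close> is an involution on the subsets of
  \<open>{1..n}\<close>. Adding the sum to its flipped copy gives the factor 2, and each of the
  \<open>2 ^ n\<close> pairs contributes at least \<open>k\<close>.\<close>

lemma sum_signs_ge:
  fixes f :: "(nat \<Rightarrow> real) \<Rightarrow> real"
  assumes "j \<in> {1..n}"
    and "\<And>S. k \<le> f ((signs S)(j := 1)) + f ((signs S)(j := -1))"
  shows "2 ^ n * k \<le> 2 * (\<Sum>S\<in>Pow {1..n}. f (signs S))"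
proof -
  define flip where "flip S = (if j \<in> S then S - {j} else insert j S)" for S
  have "signs S = (signs S)(j := 1) \<and> signs (flip S) = (signs S)(j := -1) \<or>
      signs S = (signs S)(j := -1) \<and> signs (flip S) = (signs S)(j := 1)" for S
    by (auto simp: flip_def signs_def fun_eq_iff)
  then have *: "k \<le> f (signs S) + f (signs (flip S))" for S
    using assms(2)[of S] by (metis add.commute)
  have "(\<Sum>S\<in>Pow {1..n}. f (signs (flip S))) = (\<Sum>S\<in>Pow {1..n}. f (signs S))"
    using assms(1) by (intro sum.reindex_bij_witness[of _ flip flip]) (auto simp: flip_def)
  moreover have "(\<Sum>S\<in>Pow {1..n}. k) \<le> (\<Sum>S\<in>Pow {1..n}. f (signs S) + f (signs (flip S)))"
    by (intro sum_mono *)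
  ultimately show ?thesis
    by (simp add: sum.distrib card_Pow)
qed

text \<open>No edge is excluded for \<open>j = 1\<close>: no block precedes the first, so nothing
  can be learnt about \<open>e 1\<close> ahead of time. This lets \<open>n = 1\<close> work with two
  arbitrary actions.\<close>

locale hard_instance =
  fixes K M n :: nat and E :: "(nat \<times> nat) set" and e :: "nat \<Rightarrow> nat" and \<Delta> :: real
  assumes \<Delta>: "0 \<le> \<Delta>" "\<Delta> \<le> 1/2"
    and inj_e: "inj_on e {0..n}" and e_range: "e ` {0..n} \<subseteq> {1..K}"
    and n: "1 \<le> n" "n \<le> M"
    and no_edge: "\<And>i j. \<lbrakk>i < j; 2 \<le> j; j \<le> n\<rbrakk> \<Longrightarrow> (e i, e j) \<notin> E"
begin

text \<open>The entries of \<open>\<theta>\<close> are the signs \<open>\<plusminus>1\<close>, or \<open>0\<close> for the reference environment.\<close>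

definition mean :: "(nat \<Rightarrow> real) \<Rightarrow> nat \<Rightarrow> nat \<Rightarrow> real" where
  "mean \<theta> c a = (if c \<in> {1..n} then
     if a = e 0 then 1/2 else if a = e c then 1/2 + \<Delta> * \<theta> c else 0 else 0)"

text \<open>The entries of \<open>e 0\<close> are constant and coin \<open>c\<close> appears only at
  \<open>(c, e c)\<close>, so information on \<open>\<theta> c\<close> comes only from actions with
  an edge to \<open>e c\<close>.\<close>

definition reward :: "(nat \<Rightarrow> bool) \<Rightarrow> reward_vector" where
  "reward b = (\<lambda>(c, a). if c \<in> {1..n} then
     if a = e 0 then 1/2 else if a = e c then of_bool (b c) else 0 else 0)"

definition coins :: "(nat \<Rightarrow> real) \<Rightarrow> (nat \<Rightarrow> bool) pmf" where
  "coins \<theta> = Pi_pmf {1..n} False (\<lambda>j. bernoulli_pmf (1/2 + \<Delta> * \<theta> j))"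

definition reward_law :: "(nat \<Rightarrow> real) \<Rightarrow> reward_vector pmf" where
  "reward_law \<theta> = map_pmf reward (coins \<theta>)"

definition gap :: "(nat \<Rightarrow> real) \<Rightarrow> nat \<Rightarrow> nat \<Rightarrow> real" where
  "gap \<theta> c a = (MAX b\<in>{1..K}. mean \<theta> c b) - mean \<theta> c a"

text \<open>The likelihood ratio of the observation after action \<open>a\<close> between \<open>\<theta> j = s\<close> and \<open>\<theta> j = 0\<close>. It always
  is \<open>1 \<plusminus> 2\<Delta>s\<close> or \<open>1\<close>, so that identities between likelihoods need no support conditions.\<close>

definition weight :: "nat \<Rightarrow> real \<Rightarrow> nat \<Rightarrow> reward_vector \<Rightarrow> real" where
  "weight j s a x = (if (a, e j) \<in> E then 1 + 2 * \<Delta> * s * (if x (j, e j) = 1 then 1 else -1) else 1)"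

section \<open>Reward laws and the environments they define\<close>

lemma finite_reward_law: "finite (set_pmf (reward_law \<theta>))"
  unfolding reward_law_def coins_def
  by (auto simp: set_Pi_pmf intro!: finite_imageI finite_PiE_dflt)

lemma e_eq_iff: "\<lbrakk>i \<le> n; j \<le> n\<rbrakk> \<Longrightarrow> e i = e j \<longleftrightarrow> i = j"
  using inj_e by (auto simp: inj_on_eq_iff)

lemma prob_bounds:
  assumes "\<bar>s\<bar> \<le> 1" shows "0 \<le> 1/2 + \<Delta> * s" "1/2 + \<Delta> * s \<le> 1"
proof -
  have "\<bar>\<Delta> * s\<bar> \<le> 1/2 * 1"
    unfolding abs_mult using \<Delta> assms by (intro mult_mono) auto
  then show "0 \<le> 1/2 + \<Delta> * s" "1/2 + \<Delta> * s \<le> 1"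
    by auto
qed

text \<open>Conditioning on coin \<open>j\<close>. The law \<open>R\<close> of the other coins does
  not involve \<open>s\<close>, so expectations for different \<open>s\<close> differ only in the
  two coefficients.\<close>

lemma expectation_reward_law_upd:
  fixes g :: "reward_vector \<Rightarrow> real" and \<theta> :: "nat \<Rightarrow> real"
  assumes j: "j \<in> {1..n}" and s: "\<bar>s\<bar> \<le> 1"
  defines "R \<equiv> Pi_pmf ({1..n} - {j}) False (\<lambda>i. bernoulli_pmf (1/2 + \<Delta> * \<theta> i))"
  shows "measure_pmf.expectation (reward_law (\<theta>(j := s))) g =
    (1/2 + \<Delta> * s) * measure_pmf.expectation R (\<lambda>b. g (reward (b(j := True)))) +
    (1/2 - \<Delta> * s) * measure_pmf.expectation R (\<lambda>b. g (reward (b(j := False))))"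
proof -
  have I: "{1..n} = insert j ({1..n} - {j})"
    using j by auto
  have "Pi_pmf ({1..n} - {j}) False (\<lambda>i. bernoulli_pmf (1/2 + \<Delta> * (\<theta>(j := s)) i)) = R"
    unfolding R_def by (rule Pi_pmf_cong) auto
  then have "coins (\<theta>(j := s)) = bind_pmf (bernoulli_pmf (1/2 + \<Delta> * s))
      (\<lambda>y. map_pmf (\<lambda>b. b(j := y)) R)"
    unfolding coins_def by (subst I, subst Pi_pmf_insert') (auto simp: map_pmf_def)
  moreover have "finite (set_pmf R)"
    unfolding R_def by (auto simp: set_Pi_pmf intro!: finite_PiE_dflt)
  ultimately show ?thesis
    unfolding reward_law_def using prob_bounds[OF s]
    by (simp add: expectation_bind_pmf_finite algebra_simps)
qed

text \<open>With an edge to \<open>e j\<close>, coin \<open>j\<close> is visible and its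
  probabilities \<open>1/2 \<plusminus> \<Delta> * s\<close> are the fair ones times the weight.
  Without one, the observation does not depend on coin \<open>j\<close>.\<close>

lemma expectation_reward_law_observed:
  fixes g :: "reward_vector \<Rightarrow> real"
  assumes j: "j \<in> {1..n}" and s: "\<bar>s\<bar> \<le> 1"
  shows "measure_pmf.expectation (reward_law (\<theta>(j := s))) (\<lambda>x. g (restrict x (observed M E a))) =
    measure_pmf.expectation (reward_law (\<theta>(j := 0)))
      (\<lambda>x. g (restrict x (observed M E a)) * weight j s a (restrict x (observed M E a)))"
proof -
  have zero: "\<bar>0 :: real\<bar> \<le> 1"
    by simp
  note upd = expectation_reward_law_upd[OF j s] expectation_reward_law_upd[OF j zero]
  show ?thesis
  proof (cases "(a, e j) \<in> E")
    case True
    have "reward (b(j := y)) (j, e j) = of_bool y" for b y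
      using j e_eq_iff[of j 0] by (simp add: reward_def)
    moreover have "(j, e j) \<in> observed M E a"
      using True j n by (auto simp: observed_def)
    ultimately show ?thesis
      unfolding upd using True
        by (simp add: weight_def) (simp add: algebra_simps add_divide_distrib diff_divide_distrib)
  next
    case False
    have "restrict (reward (b(j := y))) (observed M E a) = restrict (reward b) (observed M E a)" for b y
      using False by (auto simp: fun_eq_iff reward_def observed_def restrict_def)
    then show ?thesis
      unfolding upd using False by (simp add: weight_def) (simp add: algebra_simps)
  qed
qed

lemma mean_in_unit:
  assumes "\<And>j. \<bar>\<theta> j\<bar> \<le> 1" shows "mean \<theta> c a \<in> {0..1}"
  using prob_bounds[OF assms[of c]] by (auto simp: mean_def)

lemma expectation_reward_law:
  assumes "\<And>j. \<bar>\<theta> j\<bar> \<le> 1"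
  shows "measure_pmf.expectation (reward_law \<theta>) (\<lambda>x. x (c, a)) = mean \<theta> c a"
proof (cases "c \<in> {1..n}")
  case True
  then show ?thesis
    using expectation_reward_law_upd[OF True assms[of c], of \<theta> "\<lambda>x. x (c, a)"]
    by (auto simp: reward_def mean_def field_simps)
next
  case False
  then have "reward b (c, a) = 0" "mean \<theta> c a = 0" for b
    by (auto simp: reward_def mean_def)
  then show ?thesis
    by (simp add: reward_law_def)
qed

lemma environment:
  assumes "\<And>j. \<bar>\<theta> j\<bar> \<le> 1"
  shows "(mean \<theta>, \<lambda>_. reward_measure K M (reward_law \<theta>)) \<in> environments K M T"
proof (rule reward_measure_in_environments)
  show "mean \<theta> c a \<in> {0..1}" for c a
    by (rule mean_in_unit[OF assms])
  show "x (c, a) \<in> {0..1}" if "x \<in> set_pmf (reward_law \<theta>)" for x c a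
    using that by (auto simp: reward_law_def reward_def)
  show "measure_pmf.expectation (reward_law \<theta>) (\<lambda>x. x (c, a)) = mean \<theta> c a" for c a
    by (rule expectation_reward_law[OF assms])
qed

section \<open>Suboptimality gaps\<close>

lemma mean_le_Max: "b \<in> {1..K} \<Longrightarrow> mean \<theta> c b \<le> (MAX b\<in>{1..K}. mean \<theta> c b)"
  by (intro Max_ge) auto

lemma gap_nonneg: "a \<in> {1..K} \<Longrightarrow> 0 \<le> gap \<theta> c a"
  using mean_le_Max[of a \<theta> c] by (simp add: gap_def)

lemma e_in: "i \<le> n \<Longrightarrow> e i \<in> {1..K}"
  using e_range by force

lemma half_le_Max: "c \<in> {1..n} \<Longrightarrow> 1/2 \<le> (MAX b\<in>{1..K}. mean \<theta> c b)"
  using mean_le_Max[OF e_in[of 0], of \<theta> c] by (simp add: mean_def del: Max_ge_iff)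

lemma gap_bad_action:
  assumes "c \<in> {1..n}" "a \<noteq> e 0" "a \<noteq> e c"
  shows "1/2 \<le> gap \<theta> c a"
proof -
  have "mean \<theta> c a = 0"
    using assms by (simp add: mean_def)
  then show ?thesis
    using half_le_Max[OF assms(1), of \<theta>] by (simp add: gap_def)
qed

text \<open>With sign 1 only \<open>e c\<close> attains more than \<open>1/2\<close>. Together with
  the loss of \<open>e c\<close> against \<open>e 0\<close> for sign -1, this leaves no choice of
  action that is good for both signs.\<close>

lemma gap_missed_action:
  assumes "c \<in> {1..n}" "a \<noteq> e c" "\<theta> c = 1"
  shows "\<Delta> \<le> gap \<theta> c a"
proof -
  have "mean \<theta> c (e c) = 1/2 + \<Delta>" "mean \<theta> c a \<le> 1/2"
    using assms e_eq_iff[of c 0] by (auto simp: mean_def)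
  then show ?thesis
    using mean_le_Max[OF e_in[of c], of \<theta> c] assms(1) unfolding gap_def by fastforce
qed

lemma gap_wrong_action:
  assumes "c \<in> {1..n}" "\<theta> c = -1"
  shows "\<Delta> \<le> gap \<theta> c (e c)"
proof -
  have "mean \<theta> c (e c) = 1/2 - \<Delta>"
    using assms e_eq_iff[of c 0] by (auto simp: mean_def)
  then show ?thesis
    using half_le_Max[OF assms(1), of \<theta>] unfolding gap_def by linarith
qed

section \<open>Observation counts and likelihood ratios\<close>

definition observations :: "nat \<Rightarrow> history \<Rightarrow> real" where
  "observations j h = (\<Sum>(c, a, x)\<leftarrow>h. of_bool ((a, e j) \<in> E))"

definition likelihood :: "nat \<Rightarrow> real \<Rightarrow> history \<Rightarrow> real" where
  "likelihood j s h = (\<Prod>(c, a, x)\<leftarrow>h. weight j s a x)"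

lemma likelihood_nonneg: "\<bar>s\<bar> \<le> 1 \<Longrightarrow> 0 \<le> likelihood j s h"
proof (induction h)
  case (Cons z h)
  obtain c a x where "z = (c, a, x)"
    by (cases z)
  moreover have "0 \<le> weight j s a x"
    using prob_bounds[OF Cons.prems] prob_bounds[of "- s"] Cons.prems by (auto simp: weight_def)
  ultimately show ?case
    using Cons by (simp add: likelihood_def)
qed (simp add: likelihood_def)

text \<open>Whatever value of \<open>e j\<close> is seen, the two ratios multiply to
  \<open>(1 + 2 * \<Delta>) * (1 - 2 * \<Delta>)\<close>, so the product depends on the history only
  through the number of observations. The lower bound is Bernoulli's inequality.\<close>

lemma likelihood_product:
  fixes j :: nat
  defines "v h \<equiv> likelihood j 1 h * likelihood j (-1) h"
  shows "v h \<le> 1" "1 - 4 * \<Delta>\<^sup>2 * observations j h \<le> v h"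
proof -
  have "0 \<le> v h \<and> v h \<le> 1 \<and> 1 - 4 * \<Delta>\<^sup>2 * observations j h \<le> v h"
  proof (induction h)
    case (Cons z h)
    obtain c a x where z: "z = (c, a, x)"
      by (cases z)
    define d where "d = 4 * \<Delta>\<^sup>2"
    have d: "0 \<le> d" "d \<le> 1"
      using \<Delta> power_mono[of \<Delta> "1/2" 2] by (auto simp: d_def power2_eq_square)
    have "v (z # h) = (if (a, e j) \<in> E then 1 - d else 1) * v h"
      by (auto simp: v_def likelihood_def z weight_def d_def algebra_simps power2_eq_square)
    moreover have "observations j (z # h) = of_bool ((a, e j) \<in> E) + observations j h"
      by (simp add: observations_def z)
    moreover have "d * v h \<le> d" "d * v h \<le> v h" "0 \<le> d * v h"
      using Cons d by (auto simp: mult_left_le mult_left_le_one_le)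
    then have "v h - d \<le> (1 - d) * v h" "(1 - d) * v h \<le> 1" "0 \<le> (1 - d) * v h"
      using Cons by (auto simp: algebra_simps)
    ultimately show ?case
      using Cons d by (auto simp: d_def[symmetric] algebra_simps)
  qed (simp add: v_def likelihood_def observations_def)
  then show "v h \<le> 1" "1 - 4 * \<Delta>\<^sup>2 * observations j h \<le> v h"
    by auto
qed

section \<open>The cost of not knowing one sign in one round\<close>

context
  fixes \<pi> :: policy and c :: "nat \<Rightarrow> nat"
  assumes \<pi>: "\<pi> \<in> policies K M E"
begin

abbreviation hist :: "(nat \<Rightarrow> real) \<Rightarrow> nat \<Rightarrow> history pmf" where
  "hist \<theta> t \<equiv> history_law M E \<pi> c (reward_law \<theta>) t"

text \<open>\<open>u\<close> counts the completed rounds, so this is the regret of round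
  \<open>Suc u\<close>.\<close>

definition round_regret :: "nat \<Rightarrow> (nat \<Rightarrow> real) \<Rightarrow> real" where
  "round_regret u \<theta> = measure_pmf.expectation (hist \<theta> u)
     (\<lambda>h. measure_pmf.expectation (\<pi> h (c (Suc u))) (gap \<theta> (c (Suc u))))"

lemma finite_hist: "finite (set_pmf (hist \<theta> t))"
  by (intro finite_set_history_law finite_reward_law finite_set_policy[OF \<pi>])

lemma integrable_hist: "integrable (measure_pmf (hist \<theta> t)) (f :: history \<Rightarrow> real)"
  by (rule integrable_measure_pmf_finite[OF finite_hist])

lemma set_policy: "a \<in> set_pmf (\<pi> h x) \<Longrightarrow> a \<in> {1..K}"
  using \<pi> unfolding policies_def by blast

lemma round_regret_nonneg: "0 \<le> round_regret u \<theta>"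
  unfolding round_regret_def
  by (intro integral_nonneg_AE AE_pmfI gap_nonneg set_policy)

lemma expectation_history_regret:
  "measure_pmf.expectation (hist \<theta> t) (history_regret K (mean \<theta>)) = (\<Sum>u<t. round_regret u \<theta>)"
  unfolding round_regret_def history_regret_def[abs_def] gap_def[symmetric]
  by (intro expectation_history_law_sum_list finite_reward_law finite_set_policy[OF \<pi>])

lemma expectation_hist_upd:
  assumes "j \<in> {1..n}" "\<bar>s\<bar> \<le> 1"
  shows "measure_pmf.expectation (hist (\<theta>(j := s)) t) f =
    measure_pmf.expectation (hist (\<theta>(j := 0)) t) (\<lambda>h. f h * likelihood j s h)"
  unfolding likelihood_def
  by (intro expectation_history_law_change_of_measure finite_reward_law finite_set_policy[OF \<pi>]
      expectation_reward_law_observed assms)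

text \<open>Playing \<open>e j\<close> with probability \<open>p h\<close> is a randomised test for
  the sign: its two errors each cost \<open>\<Delta>\<close>. Both are moved to the reference
  environment \<open>\<theta> j = 0\<close>, where \<open>overlap_bound\<close> and
  \<open>likelihood_product\<close> bound their sum for each history.\<close>

lemma round_regret_pair:
  assumes j: "j \<in> {1..n}" and cu: "c (Suc u) = j"
  shows "\<Delta> * (1/2 - 4 * \<Delta>\<^sup>2 * measure_pmf.expectation (hist (\<theta>(j := 0)) u) (observations j))
    \<le> round_regret u (\<theta>(j := 1)) + round_regret u (\<theta>(j := -1))"
proof -
  let ?Q = "hist (\<theta>(j := 0)) u" and ?E = "\<lambda>p. measure_pmf.expectation p :: (_ \<Rightarrow> real) \<Rightarrow> real"
  define p where "p h = pmf (\<pi> h j) (e j)" for h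
  have p: "0 \<le> p h" "p h \<le> 1" for h
    by (auto simp: p_def pmf_le_1)
  have ind: "measure_pmf.expectation (\<pi> h j) (\<lambda>a. \<Delta> * indicator {e j} a) = \<Delta> * p h" for h
    by (simp add: p_def measure_pmf_single)
  have "\<Delta> * p h \<le> measure_pmf.expectation (\<pi> h j) (gap (\<theta>(j := -1)) j)" for h
    unfolding ind[symmetric]
    using gap_wrong_action[OF j, of "\<theta>(j := -1)"] gap_nonneg set_policy
    by (intro expectation_mono_finite finite_set_policy[OF \<pi>]) (auto simp: indicator_def)
  then have minus: "?E (hist (\<theta>(j := -1)) u) (\<lambda>h. \<Delta> * p h) \<le> round_regret u (\<theta>(j := -1))"
    unfolding round_regret_def cu by (intro expectation_mono_finite finite_hist)
  have "\<Delta> * (1 - p h) = measure_pmf.expectation (\<pi> h j) (\<lambda>a. \<Delta> - \<Delta> * indicator {e j} a)" for h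
    by (simp add: p_def measure_pmf_single algebra_simps
        integrable_measure_pmf_finite[OF finite_set_policy[OF \<pi>]])
  then have "\<Delta> * (1 - p h) \<le> measure_pmf.expectation (\<pi> h j) (gap (\<theta>(j := 1)) j)" for h
    using gap_missed_action[OF j, of _ "\<theta>(j := 1)"] gap_nonneg set_policy
    by (simp only:, intro expectation_mono_finite finite_set_policy[OF \<pi>]) (auto simp: indicator_def)
  then have plus: "?E (hist (\<theta>(j := 1)) u) (\<lambda>h. \<Delta> * (1 - p h)) \<le> round_regret u (\<theta>(j := 1))"
    unfolding round_regret_def cu by (intro expectation_mono_finite finite_hist)
  let ?X = "likelihood j 1" and ?Y = "likelihood j (-1)"
  have one: "?E ?Q ?X = 1" "?E ?Q ?Y = 1"
    using expectation_hist_upd[OF j, of 1 \<theta> u "\<lambda>_. 1"] expectation_hist_upd[OF j, of "-1" \<theta> u "\<lambda>_. 1"]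
    by auto
  \<comment> \<open>Both likelihood ratios have mean 1 under the reference law, so
    \<open>1/2\<close> arises as \<open>1 - (1 + 1) / 4\<close>.\<close>
  have "1/2 - 4 * \<Delta>\<^sup>2 * ?E ?Q (observations j) =
      ?E ?Q (\<lambda>h. 1 - 4 * \<Delta>\<^sup>2 * observations j h - (?X h + ?Y h) / 4)"
    by (simp add: integrable_hist one)
  also have "\<dots> \<le> ?E ?Q (\<lambda>h. (1 - p h) * ?X h + p h * ?Y h)"
  proof (intro expectation_mono_finite finite_hist)
    fix h
    show "1 - 4 * \<Delta>\<^sup>2 * observations j h - (?X h + ?Y h) / 4 \<le> (1 - p h) * ?X h + p h * ?Y h"
      using overlap_bound[of "?X h" "?Y h" "p h"] likelihood_nonneg[of 1 j h] likelihood_nonneg[of "-1" j h]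
        likelihood_product[of j h] p[of h] by auto
  qed
  finally have "\<Delta> * (1/2 - 4 * \<Delta>\<^sup>2 * ?E ?Q (observations j)) \<le>
      \<Delta> * ?E ?Q (\<lambda>h. (1 - p h) * ?X h + p h * ?Y h)"
    using \<Delta> by (intro mult_left_mono)
  also have "\<dots> = ?E ?Q (\<lambda>h. \<Delta> * ((1 - p h) * ?X h + p h * ?Y h))"
    by (rule integral_mult_right_zero[symmetric])
  also have "\<dots> = ?E ?Q (\<lambda>h. \<Delta> * (1 - p h) * ?X h + \<Delta> * p h * ?Y h)"
    by (simp only: distrib_left mult.assoc)
  also have "\<dots> = ?E ?Q (\<lambda>h. \<Delta> * (1 - p h) * ?X h) + ?E ?Q (\<lambda>h. \<Delta> * p h * ?Y h)"
    by (rule Bochner_Integration.integral_add[OF integrable_hist integrable_hist])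
  also have "\<dots> = ?E (hist (\<theta>(j := 1)) u) (\<lambda>h. \<Delta> * (1 - p h)) + ?E (hist (\<theta>(j := -1)) u) (\<lambda>h. \<Delta> * p h)"
    using expectation_hist_upd[OF j, of 1 \<theta> u "\<lambda>h. \<Delta> * (1 - p h)"]
      expectation_hist_upd[OF j, of "-1" \<theta> u "\<lambda>h. \<Delta> * p h"] by simp
  finally show ?thesis
    using plus minus by simp
qed

section \<open>The block schedule and averaging over the signs\<close>

context
  fixes T L :: nat and R :: real
  assumes L: "0 < L" "n * L \<le> T" and c: "\<And>u. c (Suc u) = min n (u div L + 1)"
    and R: "\<And>\<theta>. range \<theta> \<subseteq> {-1, 0, 1} \<Longrightarrow> (\<Sum>u<T. round_regret u \<theta>) \<le> R"
begin

text \<open>The current block contributes at most one observation per round, hence \<open>L\<close>.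
  In an earlier block, an action that reveals \<open>e j\<close> is neither \<open>e 0\<close> nor
  the good candidate of that block, so it costs at least \<open>1/2\<close> and the number of such
  observations is at most twice the regret.\<close>

lemma expectation_observations_le:
  assumes u: "u < n * L" and \<theta>: "range \<theta> \<subseteq> {-1, 0, 1}"
  shows "measure_pmf.expectation (hist \<theta> u) (observations (u div L + 1)) \<le> L + 2 * R"
proof -
  define j where "j = u div L + 1"
  have j: "j \<in> {1..n}"
    using u L by (auto simp: j_def less_mult_imp_div_less Suc_le_eq)
  let ?f = "\<lambda>v. measure_pmf.expectation (hist \<theta> v)
      (\<lambda>h. measure_pmf.expectation (\<pi> h (c (Suc v))) (\<lambda>a. of_bool ((a, e j) \<in> E)) :: real)"
  have "measure_pmf.expectation (hist \<theta> u) (observations j) = (\<Sum>v<u. ?f v)"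
    unfolding observations_def[abs_def]
    by (intro expectation_history_law_sum_list finite_reward_law finite_set_policy[OF \<pi>])
  also have "\<dots> \<le> (\<Sum>v<u. of_bool (v div L = u div L) + 2 * round_regret v \<theta>)"
  proof (intro sum_mono)
    fix v assume v: "v \<in> {..<u}"
    show "?f v \<le> of_bool (v div L = u div L) + 2 * round_regret v \<theta>"
    proof (cases "v div L = u div L")
      case True
      have "?f v \<le> measure_pmf.expectation (hist \<theta> v) (\<lambda>h. measure_pmf.expectation (\<pi> h (c (Suc v))) (\<lambda>_. 1))"
        by (intro expectation_mono_finite finite_hist finite_set_policy[OF \<pi>]) auto
      then show ?thesis
        using True round_regret_nonneg[of v \<theta>] by simp
    next
      case False
      then have less: "v div L < u div L"
        using v by (simp add: div_le_mono order_le_neq_trans)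
      \<comment> \<open>An earlier block exists, so \<open>j\<close> is at least 2 and
        \<open>no_edge\<close> applies.\<close>
      then have cv: "c (Suc v) = v div L + 1" "c (Suc v) < j" "c (Suc v) \<in> {1..n}" "2 \<le> j"
        using j by (auto simp: c j_def)
      have "of_bool ((a, e j) \<in> E) \<le> 2 * gap \<theta> (c (Suc v)) a" if a: "a \<in> {1..K}" for a
      proof (cases "(a, e j) \<in> E")
        case True
        then have "a \<noteq> e 0" "a \<noteq> e (c (Suc v))"
          using no_edge[of 0 j] no_edge[of "c (Suc v)" j] cv j by auto
        then show ?thesis
          using gap_bad_action[OF cv(3), of a \<theta>] by auto
      qed (use gap_nonneg[OF a] in auto)
      then have "?f v \<le> measure_pmf.expectation (hist \<theta> v)
          (\<lambda>h. measure_pmf.expectation (\<pi> h (c (Suc v))) (\<lambda>a. 2 * gap \<theta> (c (Suc v)) a))"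
        by (intro expectation_mono_finite finite_hist finite_set_policy[OF \<pi>]) (blast dest: set_policy)
      then show ?thesis
        using False by (simp add: round_regret_def)
    qed
  qed
  also have "\<dots> = card {v. v < u \<and> v div L = u div L} + 2 * (\<Sum>v<u. round_regret v \<theta>)"
    by (simp add: sum.distrib sum_distrib_left Int_def)
  also have "card {v. v < u \<and> v div L = u div L} \<le> card {u div L * L..<u div L * L + L}"
  proof (intro card_mono subsetI)
    fix v assume "v \<in> {v. v < u \<and> v div L = u div L}"
    then show "v \<in> {u div L * L..<u div L * L + L}"
      using L(1) div_mult_mod_eq[of v L] mod_less_divisor[OF L(1), of v] by auto
  qed simp
  also have "(\<Sum>v<u. round_regret v \<theta>) \<le> (\<Sum>v<T. round_regret v \<theta>)"
    using u L by (intro sum_mono2 round_regret_nonneg) auto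
  also have "\<dots> \<le> R"
    by (rule R[OF \<theta>])
  finally show ?thesis
    by (simp add: j_def)
qed

text \<open>Averaged over the sign vectors, each of the \<open>n * L\<close> block rounds costs at
  least \<open>k / 2\<close>; the remaining rounds are dropped. \<open>R\<close> occurs on both
  sides because it also limits what is learnt before a block.\<close>

lemma regret_lower_bound:
  "\<Delta> * (n * L) * (1/2 - 4 * \<Delta>\<^sup>2 * (L + 2 * R)) \<le> 2 * R"
proof -
  define k where "k = \<Delta> * (1/2 - 4 * \<Delta>\<^sup>2 * (L + 2 * R))"
  have "2 ^ n * k \<le> 2 * (\<Sum>S\<in>Pow {1..n}. round_regret u (signs S))" if u: "u < n * L" for u
  proof (rule sum_signs_ge)
    let ?j = "u div L + 1"
    show j: "?j \<in> {1..n}"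
      using u L by (auto simp: less_mult_imp_div_less Suc_le_eq)
    fix S
    \<comment> \<open>The observations are counted in an environment with a zero sign, which is why
      the bound \<open>R\<close> is assumed for zero entries as well.\<close>
    have "measure_pmf.expectation (hist ((signs S)(?j := 0)) u) (observations ?j) \<le> L + 2 * R"
      by (rule expectation_observations_le[OF u]) (auto simp: signs_def)
    then have "k \<le> \<Delta> * (1/2 - 4 * \<Delta>\<^sup>2 *
        measure_pmf.expectation (hist ((signs S)(?j := 0)) u) (observations ?j))"
      unfolding k_def using \<Delta> by (intro mult_left_mono diff_left_mono) auto
    also have "\<dots> \<le> round_regret u ((signs S)(?j := 1)) + round_regret u ((signs S)(?j := -1))"
      using j by (intro round_regret_pair) (auto simp: c)
    finally show "k \<le> round_regret u ((signs S)(?j := 1)) + round_regret u ((signs S)(?j := -1))" .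
  qed
  then have "(\<Sum>u<n * L. 2 ^ n * k) \<le> (\<Sum>u<n * L. 2 * (\<Sum>S\<in>Pow {1..n}. round_regret u (signs S)))"
    by (intro sum_mono) auto
  also have "\<dots> \<le> (\<Sum>u<T. 2 * (\<Sum>S\<in>Pow {1..n}. round_regret u (signs S)))"
    using L by (intro sum_mono2) (auto intro!: sum_nonneg round_regret_nonneg)
  also have "\<dots> = 2 * (\<Sum>S\<in>Pow {1..n}. \<Sum>u<T. round_regret u (signs S))"
    by (subst sum.swap) (simp add: sum_distrib_left)
  also have "\<dots> \<le> 2 * (\<Sum>S\<in>Pow {1..n}. R)"
    by (intro mult_left_mono sum_mono R) (auto simp: signs_def)
  also have "\<dots> = 2 ^ n * (2 * R)"
    by (simp add: card_Pow)
  finally have "2 ^ n * (n * L * k) \<le> 2 ^ n * (2 * R)"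
    by (simp add: algebra_simps)
  then have "n * L * k \<le> 2 * R"
    by simp
  then show ?thesis
    by (simp add: k_def mult_ac)
qed

end

end

end

section \<open>The action sequence and the choice of parameters\<close>

text \<open>A minimal element of the converse relation is a sink \<open>z\<close> of the induced
  graph, up to a self-loop. It goes first, and the rest is enumerated by induction.\<close>

lemma acyclic_enumeration:
  assumes "finite D" "acyclic (E \<inter> D \<times> D - Id)"
  shows "\<exists>xs. distinct xs \<and> set xs = D \<and> (\<forall>i j. i < j \<and> j < length xs \<longrightarrow> (xs ! i, xs ! j) \<notin> E)"
  using assms
proof (induction D rule: finite_psubset_induct)
  case (psubset D)
  let ?r = "E \<inter> D \<times> D - Id"
  show ?case
  proof (cases "D = {}")
    case False
    have "finite ?r"
      using psubset.hyps by (auto intro: finite_subset[of _ "D \<times> D"])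
    then have "wf (?r\<inverse>)"
      using psubset.prems by (rule finite_acyclic_wf_converse)
    then obtain z where z: "z \<in> D" "\<And>y. (y, z) \<in> ?r\<inverse> \<Longrightarrow> y \<notin> D"
      using False by (metis wfE_min ex_in_conv)
    have "acyclic (E \<inter> (D - {z}) \<times> (D - {z}) - Id)"
      by (rule acyclic_subset[OF psubset.prems]) auto
    with psubset.IH[of "D - {z}"] z(1) obtain xs where xs: "distinct xs" "set xs = D - {z}"
        "\<And>i j. i < j \<Longrightarrow> j < length xs \<Longrightarrow> (xs ! i, xs ! j) \<notin> E"
      by blast
    have "(z, xs ! i) \<notin> E" if "i < length xs" for i
      using z xs(2) nth_mem[OF that] by blast
    then have "((z # xs) ! i, (z # xs) ! j) \<notin> E" if "i < j" "j < length (z # xs)" for i j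
      using xs(3) that by (cases i; cases j) auto
    moreover have "distinct (z # xs)" "set (z # xs) = D"
      using xs z(1) by auto
    ultimately show ?thesis
      by blast
  qed simp
qed

lemma mas_number_attained:
  obtains D where "D \<subseteq> {1..K}" "acyclic (E \<inter> D \<times> D - Id)" "card D = mas_number K E"
proof -
  have "finite {card D | D. D \<subseteq> {1..K} \<and> acyclic (E \<inter> D \<times> D - Id)}"
    by (rule finite_subset[of _ "card ` Pow {1..K}"]) auto
  moreover have "card {} \<in> {card D | D. D \<subseteq> {1..K} \<and> acyclic (E \<inter> D \<times> D - Id)}"
    by (intro CollectI exI[of _ "{}"]) (auto simp: acyclic_def)
  ultimately have "mas_number K E \<in> {card D | D. D \<subseteq> {1..K} \<and> acyclic (E \<inter> D \<times> D - Id)}"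
    unfolding mas_number_def by (intro Max_in) blast+
  then show thesis
    using that by auto
qed

lemma mas_number_pos:
  assumes "1 \<le> K" shows "1 \<le> mas_number K E"
proof -
  have "finite {card D | D. D \<subseteq> {1..K} \<and> acyclic (E \<inter> D \<times> D - Id)}"
    by (rule finite_subset[of _ "card ` Pow {1..K}"]) auto
  moreover have "E \<inter> {1} \<times> {1} - Id = {}"
    by auto
  then have "acyclic (E \<inter> {1} \<times> {1} - Id)"
    by (simp only: acyclic_def trancl_empty) simp
  moreover have "{1} \<subseteq> {1..K}"
    using assms by simp
  ultimately have "card {1 :: nat} \<le> mas_number K E"
    unfolding mas_number_def by (intro Max_ge CollectI exI conjI) (assumption | rule refl)+
  then show ?thesis
    by simp
qed

text \<open>For \<open>mas_number K E \<ge> 2\<close> the enumeration of a maximum acyclic set gives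
  \<open>n = mas_number K E - 1\<close>, at least half the number. If it is 1, actions 1 and 2 serve
  and the edge condition is vacuous.\<close>

lemma exists_action_sequence:
  assumes "2 \<le> K"
  obtains n e where "1 \<le> n" "n \<le> mas_number K E" "mas_number K E \<le> 2 * n"
    "inj_on e {0..n}" "e ` {0..n} \<subseteq> {1..K}"
    "\<And>i j. \<lbrakk>i < j; 2 \<le> j; j \<le> n\<rbrakk> \<Longrightarrow> (e i, e j) \<notin> E"
proof (cases "mas_number K E = 1")
  case True
  show thesis
    by (rule that[of 1 "\<lambda>i. i + 1"]) (use True assms in auto)
next
  case False
  obtain D where D: "D \<subseteq> {1..K}" "acyclic (E \<inter> D \<times> D - Id)" "card D = mas_number K E"
    by (rule mas_number_attained)
  have "finite D"
    using D(1) finite_subset by auto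
  then obtain xs where xs: "distinct xs" "set xs = D"
      "\<And>i j. i < j \<Longrightarrow> j < length xs \<Longrightarrow> (xs ! i, xs ! j) \<notin> E"
    using acyclic_enumeration[OF _ D(2)] by blast
  have len: "length xs = mas_number K E"
    using xs D(3) distinct_card by fastforce
  have m: "2 \<le> mas_number K E"
    using mas_number_pos[of K E] assms False by simp
  show thesis
  proof (rule that[of "mas_number K E - 1" "(!) xs"])
    show "inj_on ((!) xs) {0..mas_number K E - 1}"
      using xs(1) len m by (auto simp: inj_on_def nth_eq_iff_index_eq)
    have "xs ! i \<in> D" if "i \<le> mas_number K E - 1" for i
      using xs(2) len m nth_mem[of i xs] that by auto
    then show "(!) xs ` {0..mas_number K E - 1} \<subseteq> {1..K}"
      using D(1) by auto
  qed (use xs(3) len m in auto)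
qed

text \<open>With \<open>r = sqrt (m * T)\<close>, the blocks cover at least half the horizon, so
  \<open>\<Delta> * (n * L) \<ge> r / 16\<close>. The choice of \<open>\<Delta>\<close> keeps the
  last factor at least \<open>1/4\<close>. The product is at least \<open>r / 64\<close>, which
  exceeds \<open>2 * R = r / 100\<close>.\<close>

lemma hard_instance_parameters:
  fixes n m T L :: nat and \<Delta> R :: real
  assumes n: "1 \<le> n" "n \<le> m" "m \<le> 2 * n" and T: "m ^ 3 \<le> T"
  defines "L \<equiv> T div n" and "\<Delta> \<equiv> sqrt (n / (32 * T))" and "R \<equiv> sqrt (real m * real T) / 200"
  shows "0 < L" "n * L \<le> T" "0 \<le> \<Delta>" "\<Delta> \<le> 1/2"
    and "2 * R < \<Delta> * (n * L) * (1/2 - 4 * \<Delta>\<^sup>2 * (L + 2 * R))"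
proof -
  have "m \<le> m ^ 3"
    by (rule self_le_power) (use n in auto)
  then have nT: "n \<le> T" and T0: "0 < T"
    using n T by auto
  show L: "0 < L" "n * L \<le> T"
    using nT n by (auto simp: L_def div_greater_zero_iff)
  have "T < n * L + n"
    using n dividend_less_div_times[of n T] by (simp add: L_def mult.commute)
  moreover have "n \<le> n * L"
    using L(1) by simp
  ultimately have TL: "T \<le> 2 * (n * L)"
    by linarith
  show "0 \<le> \<Delta>"
    by (simp add: \<Delta>_def)
  have "\<Delta> \<le> sqrt (1/4)"
    unfolding \<Delta>_def using nT T0 by (intro real_sqrt_le_mono) (simp add: field_simps)
  then show "\<Delta> \<le> 1/2"
    by (simp add: real_sqrt_divide)
  define r where "r = sqrt (real m * real T)"
  have r: "0 < r" "R = r / 200"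
    using n T0 by (auto simp: r_def R_def)
  have "(n * r)\<^sup>2 = real n ^ 2 * m * T"
    by (simp add: r_def power_mult_distrib)
  also have "\<dots> \<le> real m ^ 2 * m * T"
    using n by (intro mult_right_mono power_mono) auto
  \<comment> \<open>Here \<open>m ^ 3 \<le> T\<close> enters: it yields
    \<open>n * r \<le> T\<close>, which makes the \<open>2 * R\<close> extra observations
    affordable.\<close>
  also have "\<dots> = real (m ^ 3) * T"
    by (simp add: power2_eq_square power3_eq_cube)
  also have "\<dots> \<le> real T ^ 2"
    using T by (simp add: power2_eq_square mult_right_mono del: of_nat_power)
  finally have nr: "n * r \<le> T"
    by (rule power2_le_imp_le) simp
  have D2: "\<Delta>\<^sup>2 = n / (32 * T)"
    by (simp add: \<Delta>_def)
  have "real n * L \<le> T"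
    using of_nat_mono[OF L(2), where 'a = real] by simp
  moreover have "n * R \<le> T / 200"
    using nr by (simp add: r(2))
  ultimately have "real n * L + 2 * (n * R) \<le> 2 * T"
    by linarith
  then have "4 * \<Delta>\<^sup>2 * (L + 2 * R) \<le> 1/4"
    using T0 by (simp add: D2 field_simps)
  moreover have "(r / 8)\<^sup>2 \<le> (\<Delta> * T)\<^sup>2"
  proof -
    have "real m * T \<le> (2 * real n) * T"
      using n(3) by (intro mult_right_mono) linarith+
    moreover have "(r / 8)\<^sup>2 = real m * T / 64"
      by (simp add: power_divide r_def)
    moreover have "(\<Delta> * T)\<^sup>2 = n * T / 32"
      unfolding power_mult_distrib D2 using T0 by (simp add: power2_eq_square)
    ultimately show ?thesis
      by simp
  qed
  then have "r / 8 \<le> \<Delta> * T"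
    by (rule power2_le_imp_le) (simp add: \<Delta>_def)
  moreover have "\<Delta> * T \<le> \<Delta> * (2 * (n * L))"
    using of_nat_mono[OF TL, where 'a = real] \<open>0 \<le> \<Delta>\<close> by (intro mult_left_mono) simp_all
  ultimately have "r / 16 \<le> \<Delta> * (n * L)" "1/4 \<le> 1/2 - 4 * \<Delta>\<^sup>2 * (L + 2 * R)"
    by (simp_all add: mult_ac)
  then have "r / 16 * (1/4) \<le> \<Delta> * (n * L) * (1/2 - 4 * \<Delta>\<^sup>2 * (L + 2 * R))"
    using r by (intro mult_mono) auto
  then show "2 * R < \<Delta> * (n * L) * (1/2 - 4 * \<Delta>\<^sup>2 * (L + 2 * R))"
    using r by linarith
qed

text \<open>The argument is by contradiction, since the count of observations needs an upper bound
  on the regret: a policy with regret below \<open>R\<close> satisfies the hypotheses of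
  \<open>regret_lower_bound\<close>, whose conclusion contradicts the choice of parameters.\<close>

lemma minimax_regret_ge:
  assumes K: "2 \<le> K" and E: "E \<subseteq> {1..K} \<times> {1..K}" and M: "mas_number K E \<le> M"
    and T: "mas_number K E ^ 3 \<le> T"
  shows "ereal (1/200 * sqrt (real (mas_number K E) * real T)) \<le> minimax_regret K M T E"
proof (rule ccontr)
  define R where "R = sqrt (real (mas_number K E) * real T) / 200"
  assume "\<not> ?thesis"
  then obtain \<pi> where \<pi>: "\<pi> \<in> policies K M E" and less: "regret K M T E \<pi> < ereal R"
    by (auto simp: minimax_regret_def INF_less_iff not_le R_def)
  obtain n e where n: "1 \<le> n" "n \<le> mas_number K E" "mas_number K E \<le> 2 * n"
    and e: "inj_on e {0..n}" "e ` {0..n} \<subseteq> {1..K}"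
      "\<And>i j. \<lbrakk>i < j; 2 \<le> j; j \<le> n\<rbrakk> \<Longrightarrow> (e i, e j) \<notin> E"
    using exists_action_sequence[OF K] by metis
  define L and \<Delta> where "L = T div n" and "\<Delta> = sqrt (n / (32 * T))"
  note params = hard_instance_parameters[OF n T, folded L_def \<Delta>_def R_def]
  interpret hard_instance K M n E e \<Delta>
    by unfold_locales (use params(3,4) e n M in auto)
  \<comment> \<open>Rounds are numbered from 1, hence \<open>t - 1\<close>; \<open>min n\<close>
    leaves the rounds after the last full block in context \<open>n\<close>.\<close>
  define c where "c t = min n ((t - 1) div L + 1)" for t
  have c: "c \<in> {1..T} \<rightarrow> {1..M}"
    using n M by (auto simp: c_def)
  have reg: "(\<Sum>u<T. round_regret \<pi> c u \<theta>) \<le> R" if "range \<theta> \<subseteq> {-1, 0, 1}" for \<theta>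
  proof -
    have "\<bar>\<theta> j\<bar> \<le> 1" for j
      using that by (auto simp: image_subset_iff elim!: allE[of _ j])
    from environment[OF this]
    have "ereal (expected_regret K M T E \<pi> c (mean \<theta>) (\<lambda>_. reward_measure K M (reward_law \<theta>)))
        \<le> regret K M T E \<pi>"
      unfolding regret_def using c
      by (intro SUP_upper2[of c] SUP_upper2[of "(mean \<theta>, \<lambda>_. reward_measure K M (reward_law \<theta>))"]) auto
    also have "expected_regret K M T E \<pi> c (mean \<theta>) (\<lambda>_. reward_measure K M (reward_law \<theta>)) =
        (\<Sum>u<T. round_regret \<pi> c u \<theta>)"
      using expected_regret_reward_measure[OF \<pi> c E finite_reward_law] expectation_history_regret[OF \<pi>]
      by simp
    finally show ?thesis
      using less by (metis ereal_less_eq(3) le_less_trans less_imp_le)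
  qed
  have "\<Delta> * (n * L) * (1/2 - 4 * \<Delta>\<^sup>2 * (L + 2 * R)) \<le> 2 * R"
    by (rule regret_lower_bound[OF \<pi> params(1,2) _ reg]) (simp_all add: c_def)
  then show False
    using params(5) by linarith
qed

theorem corollary1:
  "\<exists>c\<^sub>0 :: real. c\<^sub>0 > 0 \<and>
     (\<forall>(K :: nat) (M :: nat) (T :: nat) (E :: (nat \<times> nat) set).
        K \<ge> 2 \<and> M \<ge> 1 \<and> T \<ge> 1 \<and> E \<subseteq> {1..K} \<times> {1..K} \<and> strongly_observable K E \<and>
        M \<ge> mas_number K E \<and> T \<ge> mas_number K E ^ 3 \<longrightarrow>
        minimax_regret K M T E \<ge> ereal (c\<^sub>0 * sqrt (real (mas_number K E) * real T)))"
  by (intro exI[of _ "1/200"] conjI allI impI minimax_regret_ge) auto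

end
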